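(* Let $1<p<\infty$, and assume that $X=(X,d,\nu,\mu)$ is a connected metric two-measure space. Then the following conditions are equivalent: (A) $X$ satisfies a $(p-\varepsilon)$-balance condition for some $0<\varepsilon<p-1$. (B) $X$ satisfies a $\Psi$-bumped $p$-balance condition with a function $\Psi:(0,\infty)\to(0,\infty)$ for which there exist $t_0>0$ and $0<\delta<1$ such that $\Psi(t)\le\delta$ for all $0<t\le t_0$.
   Context: **Metric two-measure space.** $X=(X,d,\nu,\mu)$ is a metric space $(X,d)$ with at least two points, equipped with two positive complete Borel measures $\nu,\mu$ such that $0<\nu(B)<\infty$ and $0<\mu(B)<\infty$ for all open balls $B=B(x,r)=\{y\in X: d(y,x)<r\}$, $x\in X$, $r>0$, and such that both measures are doubling: there are constants $c_\nu,c_\mu>1$ with $\nu(2B)\le c_\nu\nu(B)$ and $\mu(2B)\le c_\mu\mu(B)$ for all balls $B$, where $tB=B(x,tr)$. It is connected if $(X,d)$ is a connected space. **Balance condition.** For $1\le t<\infty$, $X$ satisfies a $t$-balance condition if there is $C>0$ such that $$\Bigl(\frac{\mathrm{diam}(B')}{\mathrm{diam}(B)}\Bigr)^t\frac{\nu(B')}{\nu(B)}\le C\,\frac{\mu(B')}{\mu(B)}$$ whenever $B$ and $B'=B(x',r')$ are balls in $X$ with $x'\in B$ and $0<r'\le\mathrm{diam}(B)$. **Bumped balance condition.** For a function $\Psi:(0,\infty)\to(0,\infty)$, $X$ satisfies a $\Psi$-bumped $p$-balance condition if $$\Bigl(\frac{\mathrm{diam}(B')}{\mathrm{diam}(B)}\Bigr)^p\frac{\nu(B')}{\nu(B)}\le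 \Psi\Bigl(\frac{\mathrm{diam}(B')}{\mathrm{diam}(B)}\Bigr)\frac{\mu(B')}{\mu(B)}$$ whenever $B$ and $B'=B(x',r')$ are balls in $X$ with $x'\in B$ and $0<r'\le\mathrm{diam}(B)$. *)

theory Defs
  imports "HOL-Analysis.Analysis"
begin

text \<open>
  A Borel measure is one for which at least all Borel sets are measurable; being complete, it is
  in general defined on a larger sigma-algebra than \<^term>\<open>sets borel\<close>.
\<close>

definition complete_Borel_measure :: "'a::metric_space measure \<Rightarrow> bool" where
  "complete_Borel_measure M \<longleftrightarrow>
     space M = UNIV \<and> sets borel \<subseteq> sets M \<and> complete_measure M"

definition doubling_measure :: "'a::metric_space measure \<Rightarrow> bool" where
  "doubling_measure M \<longleftrightarrow>
     (\<exists>c::real. c > 1 \<and>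
        (\<forall>x r. r > 0 \<longrightarrow> emeasure M (ball x (2 * r)) \<le> ennreal c * emeasure M (ball x r)))"

definition metric_two_measure_space ::
    "'a::metric_space measure \<Rightarrow> 'a measure \<Rightarrow> bool" where
  "metric_two_measure_space \<nu> \<mu> \<longleftrightarrow>
     (\<exists>x y :: 'a. x \<noteq> y) \<and>
     complete_Borel_measure \<nu> \<and> complete_Borel_measure \<mu> \<and>
     (\<forall>x r. r > 0 \<longrightarrow> 0 < emeasure \<nu> (ball x r) \<and> emeasure \<nu> (ball x r) < \<infinity>) \<and>
     (\<forall>x r. r > 0 \<longrightarrow> 0 < emeasure \<mu> (ball x r) \<and> emeasure \<mu> (ball x r) < \<infinity>) \<and>
     doubling_measure \<nu> \<and> doubling_measure \<mu>"

text \<open>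
  A ball comes with a chosen centre and radius, as the condition on \<open>B' = B(x', r')\<close> depends on
  them. In both conditions below \<open>0 < r' \<le> diam B\<close> makes every denominator positive in a
  metric two-measure space.
\<close>

definition balance_condition ::
    "real \<Rightarrow> 'a::metric_space measure \<Rightarrow> 'a measure \<Rightarrow> bool" where
  "balance_condition t \<nu> \<mu> \<longleftrightarrow>
     (\<exists>C::real. C > 0 \<and>
        (\<forall>x r x' r'. r > 0 \<longrightarrow> x' \<in> ball x r \<longrightarrow> 0 < r' \<longrightarrow> r' \<le> diameter (ball x r) \<longrightarrow>
           (diameter (ball x' r') / diameter (ball x r)) powr t *
             (measure \<nu> (ball x' r') / measure \<nu> (ball x r))
           \<le> C * (measure \<mu> (ball x' r') / measure \<mu> (ball x r))))"

text \<open>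
  \<open>\<Psi>\<close> is meant as a function on the positive reals; in a connected space with at least two points
  every ball has positive diameter, so its values elsewhere play no role.
\<close>

definition bumped_balance_condition ::
    "(real \<Rightarrow> real) \<Rightarrow> real \<Rightarrow> 'a::metric_space measure \<Rightarrow> 'a measure \<Rightarrow> bool" where
  "bumped_balance_condition \<Psi> p \<nu> \<mu> \<longleftrightarrow>
     (\<forall>x r x' r'. r > 0 \<longrightarrow> x' \<in> ball x r \<longrightarrow> 0 < r' \<longrightarrow> r' \<le> diameter (ball x r) \<longrightarrow>
        (diameter (ball x' r') / diameter (ball x r)) powr p *
          (measure \<nu> (ball x' r') / measure \<nu> (ball x r))
        \<le> \<Psi> (diameter (ball x' r') / diameter (ball x r)) *
          (measure \<mu> (ball x' r') / measure \<mu> (ball x r)))"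

end

theory Submission
  imports Defs
begin

text \<open>
  For a ball \<open>B\<close> put \<open>Q p B = diam(B)^p \<nu>(B) / \<mu>(B)\<close>. The bumped condition says
  \<open>Q p B' \<le> \<Psi>(diam B' / diam B) Q p B\<close>, so that the \<open>(p - \<epsilon>)\<close>-balance condition is the
  bumped one with \<open>\<Psi> t = C t^\<epsilon>\<close>, and (A) implies (B). Conversely, let \<open>\<theta> = min (t\<^sub>0 / 2) (1 / 2)\<close> and
  let \<open>B\<^sub>j\<close> be the ball around \<open>x'\<close> of radius \<open>\<theta>^j diam B\<close>. By connectedness \<open>diam B\<^sub>j\<close> is
  comparable to the radius, so consecutive diameters have ratio at most \<open>2\<theta> \<le> t\<^sub>0\<close> and
  \<open>Q p B\<^sub>k \<le> \<delta>^k Q p B\<^sub>0\<close>. By doubling, \<open>B\<^sub>0\<close> is comparable to \<open>B\<close>, and \<open>B'\<close> to \<open>B\<^sub>k\<close> for \<open>k\<close> with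
  \<open>\<theta>^(k+1) diam B < r' \<le> \<theta>^k diam B\<close>. If \<open>\<delta> \<le> \<theta>^\<epsilon>\<close>, then \<open>\<delta>^k\<close> is at most a constant times
  \<open>(diam B' / diam B)^\<epsilon>\<close>.
\<close>

section \<open>Diameters of balls in a connected space\<close>

lemma diameter_ball_le:
  fixes x :: "'a::metric_space"
  assumes "r > 0"
  shows "diameter (ball x r) \<le> 2 * r"
proof (rule ccontr)
  assume "\<not> ?thesis"
  then obtain u v where "u \<in> ball x r" "v \<in> ball x r" "2 * r < dist u v"
    using diameter_lower_bounded[of "ball x r" "2 * r"] assms by auto
  then show False
    using dist_triangle3[of u v x] by simp
qed

text \<open>By connectedness \<open>dist x\<close> attains every value between 0 and
  \<open>dist x y\<close>, so for each \<open>s < r\<close> some point of the ball lies at distance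
  exactly \<open>s\<close> from its centre.\<close>

lemma le_diameter_ball_of_dist:
  fixes x y :: "'a::metric_space"
  assumes conn: "connected (UNIV :: 'a set)" and r: "0 < r" "r \<le> dist x y"
  shows "r \<le> diameter (ball x r)"
proof (rule dense_le_bounded[OF r(1)])
  fix s assume s: "0 < s" "s < r"
  have "connected (range (dist x))"
    by (intro connected_continuous_image continuous_intros conn)
  moreover have "0 \<in> range (dist x)" by (metis dist_self rangeI)
  ultimately have "{0..dist x y} \<subseteq> range (dist x)"
    by (intro connected_contains_Icc) auto
  moreover have "s \<in> {0..dist x y}" using s r by simp
  ultimately obtain w where "dist x w = s" by blast
  then show "s \<le> diameter (ball x r)"
    using diameter_bounded_bound[of "ball x r" x w] s r by auto
qed

text \<open>The hypothesis is the bound on \<open>r'\<close> in the balance conditions, now used for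
  an arbitrary centre. Either \<open>ball x r\<close> is the whole space and contains
  \<open>ball y s\<close>, or some point lies at distance at least \<open>r\<close> from
  \<open>x\<close>.\<close>

lemma le_diameter_ball:
  fixes x y :: "'a::metric_space"
  assumes conn: "connected (UNIV :: 'a set)" and r: "0 < r" "r \<le> diameter (ball y s)"
  shows "r \<le> diameter (ball x r)"
proof (cases "ball x r = UNIV")
  case True
  have "diameter (ball y s) \<le> diameter (ball x r)"
    using True bounded_ball[of x r] by (intro diameter_subset) auto
  with r show ?thesis by simp
next
  case False
  then obtain z where "r \<le> dist x z" by (auto simp: set_eq_iff not_less)
  then show ?thesis using conn r le_diameter_ball_of_dist by blast
qed

lemma diameter_ball_pos:
  fixes x a b :: "'a::metric_space"
  assumes conn: "connected (UNIV :: 'a set)" and ab: "a \<noteq> b" and r: "0 < r"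
  shows "0 < diameter (ball x r)"
proof -
  obtain c where c: "c \<noteq> x" using ab by metis
  define t where "t = min r (dist x c)"
  have "0 < t" using r c by (simp add: t_def)
  also have "t \<le> diameter (ball x t)"
    by (rule le_diameter_ball_of_dist[OF conn \<open>0 < t\<close>, of x c]) (simp add: t_def)
  also have "\<dots> \<le> diameter (ball x r)"
    by (rule diameter_subset) (auto simp: t_def)
  finally show ?thesis .
qed

section \<open>Measures of balls, for one measure at a time\<close>

definition doubling_Borel :: "'a::metric_space measure \<Rightarrow> bool" where
  "doubling_Borel M \<longleftrightarrow> sets borel \<subseteq> sets M \<and>
     (\<forall>x r. r > 0 \<longrightarrow> 0 < emeasure M (ball x r) \<and> emeasure M (ball x r) < \<infinity>) \<and>
     doubling_measure M"

lemma metric_two_measure_spaceD: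
  assumes "metric_two_measure_space \<nu> \<mu>"
  shows "doubling_Borel \<nu>" "doubling_Borel \<mu>"
  using assms
  by (auto simp: metric_two_measure_space_def doubling_Borel_def complete_Borel_measure_def)

lemma measure_ball_pos:
  assumes "doubling_Borel M" "r > 0"
  shows "0 < measure M (ball x r)"
  using assms by (auto simp: doubling_Borel_def measure_def enn2real_positive_iff)

lemma measure_ball_mono:
  assumes "doubling_Borel M" "s > 0" "ball x r \<subseteq> ball y s"
  shows "measure M (ball x r) \<le> measure M (ball y s)"
proof (rule measure_mono_fmeasurable)
  show "ball x r \<in> sets M" "ball y s \<in> fmeasurable M"
    using assms by (auto simp: doubling_Borel_def fmeasurable_def)
qed (fact assms)

lemma measure_ball_doubling:
  assumes "doubling_Borel M"
  obtains c where "c > 1"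
    "\<And>x r. r > 0 \<Longrightarrow> measure M (ball x (2 * r)) \<le> c * measure M (ball x r)"
proof -
  obtain c where c: "c > 1"
    "\<And>x r. r > 0 \<Longrightarrow> emeasure M (ball x (2 * r)) \<le> ennreal c * emeasure M (ball x r)"
    using assms unfolding doubling_Borel_def doubling_measure_def by blast
  have fin: "emeasure M (ball x r) = ennreal (measure M (ball x r))" if "r > 0" for x r
    by (rule emeasure_eq_ennreal_measure)
      (use that assms in \<open>auto simp: doubling_Borel_def less_top\<close>)
  show thesis
  proof (rule that[OF c(1)])
    fix x and r :: real assume "r > 0"
    then show "measure M (ball x (2 * r)) \<le> c * measure M (ball x r)"
      using c(2)[of r x] c(1) by (simp add: fin flip: ennreal_mult)
  qed
qed

text \<open>Iterate doubling \<open>n\<close> times with \<open>2 ^ n > K\<close>; the constant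
  depends on \<open>K\<close> but not on the ball.\<close>

lemma measure_ball_dilation:
  fixes M :: "'a::metric_space measure"
  assumes M: "doubling_Borel M" and K: "K > 0"
  obtains C where "C > 0"
    "\<And>x r. r > 0 \<Longrightarrow> measure M (ball x (K * r)) \<le> C * measure M (ball x r)"
proof -
  obtain c where c: "c > 1"
    "\<And>x r. r > 0 \<Longrightarrow> measure M (ball x (2 * r)) \<le> c * measure M (ball x r)"
    using measure_ball_doubling[OF M] by metis
  have iter: "measure M (ball x (2 ^ n * r)) \<le> c ^ n * measure M (ball x r)"
    if "r > 0" for n x r
  proof (induction n)
    case (Suc n)
    have "measure M (ball x (2 ^ Suc n * r)) \<le> c * measure M (ball x (2 ^ n * r))"
      using c(2)[of "2 ^ n * r" x] that by (simp add: mult.assoc)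
    also have "\<dots> \<le> c * (c ^ n * measure M (ball x r))"
      using c(1) Suc.IH by (intro mult_left_mono) auto
    finally show ?case by (simp add: mult.assoc)
  qed simp
  obtain n where n: "K < 2 ^ n"
    using real_arch_pow[of 2 K] by auto
  show thesis
  proof (rule that[of "c ^ n"])
    show "c ^ n > 0" using c(1) by simp
    fix x :: 'a and r :: real assume r: "r > 0"
    have "ball x (K * r) \<subseteq> ball x (2 ^ n * r)"
      using n r by (intro subset_ball mult_right_mono) auto
    then have "measure M (ball x (K * r)) \<le> measure M (ball x (2 ^ n * r))"
      using r by (intro measure_ball_mono[OF M]) auto
    also note iter[OF r]
    finally show "measure M (ball x (K * r)) \<le> c ^ n * measure M (ball x r)" .
  qed
qed

section \<open>Both conditions as inequalities between quotients\<close>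

definition ball_quotient ::
    "real \<Rightarrow> 'a::metric_space measure \<Rightarrow> 'a measure \<Rightarrow> 'a set \<Rightarrow> real" where
  "ball_quotient p \<nu> \<mu> B = diameter B powr p * measure \<nu> B / measure \<mu> B"

lemma ratio_le_iff_ball_quotient_le:
  assumes "0 < diameter B" "0 < diameter B'" "0 < measure \<nu> B"
    "0 < measure \<mu> B" "0 < measure \<mu> B'"
  shows "(diameter B' / diameter B) powr p * (measure \<nu> B' / measure \<nu> B)
           \<le> K * (measure \<mu> B' / measure \<mu> B) \<longleftrightarrow>
         ball_quotient p \<nu> \<mu> B' \<le> K * ball_quotient p \<nu> \<mu> B"
  using assms by (simp add: ball_quotient_def powr_divide field_simps)

text \<open>Lowering the exponent by \<epsilon> divides the quotient of a set by its diameter to the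
  power \<epsilon>, which cancels the extra factor.\<close>

lemma ball_quotient_exponent_shift:
  assumes "0 < diameter B" "0 < diameter B'"
  shows "ball_quotient p \<nu> \<mu> B' \<le> K * (diameter B' / diameter B) powr \<epsilon> * ball_quotient p \<nu> \<mu> B
     \<longleftrightarrow> ball_quotient (p - \<epsilon>) \<nu> \<mu> B' \<le> K * ball_quotient (p - \<epsilon>) \<nu> \<mu> B"
proof -
  have "ball_quotient (p - \<epsilon>) \<nu> \<mu> A = ball_quotient p \<nu> \<mu> A / diameter A powr \<epsilon>" for A
    by (simp add: ball_quotient_def powr_diff)
  moreover have "0 < diameter B powr \<epsilon>" "0 < diameter B' powr \<epsilon>"
    using assms by auto
  ultimately show ?thesis
    using assms by (simp add: powr_divide field_simps)
qed

text \<open>The bounds on the three factors multiply. The one for \<mu> runs in the opposite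
  direction because \<mu> stands in the denominator.\<close>

lemma ball_quotient_comparison:
  assumes "0 \<le> diameter B" "diameter B \<le> a * diameter B'" "0 < a" "0 < p"
    and "measure \<nu> B \<le> b * measure \<nu> B'"
    and "measure \<mu> B' \<le> c * measure \<mu> B" "0 < measure \<mu> B" "0 < measure \<mu> B'"
  shows "ball_quotient p \<nu> \<mu> B \<le> a powr p * b * c * ball_quotient p \<nu> \<mu> B'"
proof -
  have "0 \<le> diameter B'" using order_trans[OF assms(1,2)] assms(3) by (simp add: zero_le_mult_iff)
  then have d: "diameter B powr p \<le> a powr p * diameter B' powr p"
    using powr_mono2[of p "diameter B" "a * diameter B'"] assms by (simp add: powr_mult)
  have m: "1 / measure \<mu> B \<le> c / measure \<mu> B'"
    using assms by (simp add: field_simps)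
  have "diameter B powr p * measure \<nu> B * (1 / measure \<mu> B)
    \<le> (a powr p * diameter B' powr p) * (b * measure \<nu> B') * (c / measure \<mu> B')"
    using d m assms(5) order_trans[OF measure_nonneg assms(5)] by (intro mult_mono) auto
  then show ?thesis by (simp add: ball_quotient_def ac_simps)
qed

context
  fixes \<nu> \<mu> :: "'a::metric_space measure"
  assumes space: "metric_two_measure_space \<nu> \<mu>"
    and conn: "connected (UNIV :: 'a set)"
begin

lemma diam_pos: "r > 0 \<Longrightarrow> 0 < diameter (ball (x::'a) r)"
  using space diameter_ball_pos[OF conn] by (auto simp: metric_two_measure_space_def)

lemmas doubling = metric_two_measure_spaceD[OF space]

lemma bumped_balance_condition_iff:
  "bumped_balance_condition \<Psi> p \<nu> \<mu> \<longleftrightarrow>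
    (\<forall>x r x' r'. r > 0 \<longrightarrow> x' \<in> ball x r \<longrightarrow> 0 < r' \<longrightarrow> r' \<le> diameter (ball x r) \<longrightarrow>
       ball_quotient p \<nu> \<mu> (ball x' r')
         \<le> \<Psi> (diameter (ball x' r') / diameter (ball x r)) * ball_quotient p \<nu> \<mu> (ball x r))"
  unfolding bumped_balance_condition_def
  by (intro all_cong1 imp_cong refl ratio_le_iff_ball_quotient_le diam_pos
      measure_ball_pos doubling)

lemma balance_condition_iff_bumped_powr:
  "balance_condition (p - \<epsilon>) \<nu> \<mu> \<longleftrightarrow>
    (\<exists>C>0. bumped_balance_condition (\<lambda>t. C * t powr \<epsilon>) p \<nu> \<mu>)"
proof -
  have "(diameter (ball x' r') / diameter (ball x r)) powr (p - \<epsilon>) *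
          (measure \<nu> (ball x' r') / measure \<nu> (ball x r))
        \<le> C * (measure \<mu> (ball x' r') / measure \<mu> (ball x r)) \<longleftrightarrow>
        ball_quotient p \<nu> \<mu> (ball x' r')
         \<le> C * (diameter (ball x' r') / diameter (ball x r)) powr \<epsilon>
           * ball_quotient p \<nu> \<mu> (ball x r)"
    if "r > 0" "r' > 0" for C r r' x x'
    using that
    by (subst ratio_le_iff_ball_quotient_le)
      (simp_all add: diam_pos measure_ball_pos doubling ball_quotient_exponent_shift)
  then show ?thesis
    unfolding balance_condition_def bumped_balance_condition_iff
    by (intro ex_cong1 conj_cong all_cong1 imp_cong refl)
qed

section \<open>The two implications\<close>

lemma balance_condition_imp_small_bump:
  assumes "0 < \<epsilon>" "balance_condition (p - \<epsilon>) \<nu> \<mu>"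
  shows "\<exists>\<Psi> :: real \<Rightarrow> real. (\<forall>t>0. \<Psi> t > 0) \<and> bumped_balance_condition \<Psi> p \<nu> \<mu> \<and>
       (\<exists>t\<^sub>0>0. \<exists>\<delta>. 0 < \<delta> \<and> \<delta> < 1 \<and> (\<forall>t. 0 < t \<and> t \<le> t\<^sub>0 \<longrightarrow> \<Psi> t \<le> \<delta>))"
proof -
  obtain C where C: "C > 0" "bumped_balance_condition (\<lambda>t. C * t powr \<epsilon>) p \<nu> \<mu>"
    using assms(2) balance_condition_iff_bumped_powr by auto
  \<comment> \<open>Solves \<open>C * t powr \<epsilon> = 1 / 2\<close>; since \<epsilon> is
    positive, the bump stays below 1/2 for smaller \<open>t\<close>.\<close>
  define t\<^sub>0 where "t\<^sub>0 = (1 / (2 * C)) powr (1 / \<epsilon>)"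
  have "C * t powr \<epsilon> \<le> 1 / 2" if "0 < t" "t \<le> t\<^sub>0" for t
  proof -
    have "t powr \<epsilon> \<le> t\<^sub>0 powr \<epsilon>" using that assms(1) by (intro powr_mono2) auto
    also have "\<dots> = 1 / (2 * C)" using assms(1) C(1) by (simp add: t\<^sub>0_def powr_powr)
    finally show ?thesis using C(1) by (simp add: field_simps)
  qed
  moreover have "t\<^sub>0 > 0" using C(1) by (simp add: t\<^sub>0_def)
  ultimately show ?thesis
    using C by (intro exI[of _ "\<lambda>t. C * t powr \<epsilon>"] conjI exI[of _ t\<^sub>0] exI[of _ "1 / 2"]) auto
qed

text \<open>Each induction step applies the bumped condition to two concentric balls of radii
  \<open>R\<close> and \<open>\<theta> * R\<close>. The bound on \<open>d\<close> passes to every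
  smaller \<open>R\<close>, so \<open>le_diameter_ball\<close> gives
  \<open>R \<le> diameter (ball x R)\<close>, which makes the pair admissible.\<close>

lemma concentric_decay:
  fixes x y :: 'a
  assumes bump: "bumped_balance_condition \<Psi> p \<nu> \<mu>"
    and \<Psi>: "\<And>t. 0 < t \<Longrightarrow> t \<le> t\<^sub>0 \<Longrightarrow> \<Psi> t \<le> \<delta>" and \<delta>: "0 < \<delta>"
    and \<theta>: "0 < \<theta>" "\<theta> \<le> 1" "2 * \<theta> \<le> t\<^sub>0"
    and d: "0 < d" "d \<le> diameter (ball y s)"
  shows "ball_quotient p \<nu> \<mu> (ball x (\<theta> ^ k * d)) \<le> \<delta> ^ k * ball_quotient p \<nu> \<mu> (ball x d)"
proof (induction k)
  case (Suc k)
  define R where "R = \<theta> ^ k * d"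
  have "R \<le> d"
    using \<theta> d by (auto simp: R_def intro!: mult_left_le_one_le power_le_one)
  then have R: "0 < R" "R \<le> diameter (ball y s)"
    using \<theta> d(1) order_trans[OF \<open>R \<le> d\<close> d(2)] by (simp_all add: R_def)
  have \<theta>R: "0 < \<theta> * R" "\<theta> * R \<le> R"
    using \<theta> R by (auto simp: mult_left_le_one_le)
  have diam_R: "R \<le> diameter (ball x R)"
    using conn R by (rule le_diameter_ball)
  let ?t = "diameter (ball x (\<theta> * R)) / diameter (ball x R)"
  \<comment> \<open>The numerator is at most twice its radius and the denominator at least its
    radius.\<close>
  have "?t \<le> 2 * (\<theta> * R) / R"
    using \<theta>R R(1) diam_R by (intro frac_le diameter_ball_le) auto
  also have "\<dots> \<le> t\<^sub>0" using \<theta> R by simp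
  finally have "\<Psi> ?t \<le> \<delta>"
    using \<theta>R R by (intro \<Psi>) (auto intro: divide_pos_pos diam_pos)
  have "ball_quotient p \<nu> \<mu> (ball x (\<theta> * R)) \<le> \<Psi> ?t * ball_quotient p \<nu> \<mu> (ball x R)"
    using bump R \<theta>R diam_R unfolding bumped_balance_condition_iff by auto
  also have "\<dots> \<le> \<delta> * ball_quotient p \<nu> \<mu> (ball x R)"
    using \<open>\<Psi> ?t \<le> \<delta>\<close> by (intro mult_right_mono) (auto simp: ball_quotient_def)
  also have "\<dots> \<le> \<delta> * (\<delta> ^ k * ball_quotient p \<nu> \<mu> (ball x d))"
    using Suc.IH \<delta> by (intro mult_left_mono) (auto simp: R_def)
  finally show ?case by (simp add: R_def mult.assoc)
qed simp

lemma small_bump_imp_balance_condition: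
  assumes p: "1 < p" and bump: "bumped_balance_condition \<Psi> p \<nu> \<mu>"
    and \<Psi>: "\<And>t. 0 < t \<Longrightarrow> t \<le> t\<^sub>0 \<Longrightarrow> \<Psi> t \<le> \<delta>" and t\<^sub>0: "0 < t\<^sub>0" and \<delta>: "0 < \<delta>" "\<delta> < 1"
  shows "\<exists>\<epsilon>. 0 < \<epsilon> \<and> \<epsilon> < p - 1 \<and> balance_condition (p - \<epsilon>) \<nu> \<mu>"
proof -
  define \<theta> where "\<theta> = min (t\<^sub>0 / 2) (1 / 2)"
  have \<theta>: "0 < \<theta>" "\<theta> < 1" "2 * \<theta> \<le> t\<^sub>0" using t\<^sub>0 by (auto simp: \<theta>_def)
  \<comment> \<open>The first entry keeps \<epsilon> below \<open>p - 1\<close>, the second gives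
    \<open>\<delta> \<le> \<theta> powr \<epsilon>\<close>. Both logarithms are negative, so their
    quotient is positive.\<close>
  define \<epsilon> where "\<epsilon> = min ((p - 1) / 2) (ln \<delta> / ln \<theta>)"
  have \<epsilon>: "0 < \<epsilon>" "\<epsilon> < p - 1" "\<epsilon> \<le> ln \<delta> / ln \<theta>"
    using p \<theta> \<delta> by (auto simp: \<epsilon>_def divide_neg_neg min_less_iff_disj)
  have "ln \<delta> \<le> \<epsilon> * ln \<theta>"
    using \<epsilon>(3) \<theta> by (simp add: neg_le_divide_eq)
  then have \<delta>_le: "\<delta> \<le> \<theta> powr \<epsilon>"
    using \<delta> \<theta> by (simp add: powr_def ln_ge_iff flip: exp_le_cancel_iff[of "ln \<delta>"])
  obtain N where N: "N > 0"
    "\<And>x r. r > 0 \<Longrightarrow> measure \<nu> (ball x (4 * r)) \<le> N * measure \<nu> (ball x r)"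
    using measure_ball_dilation[OF doubling(1), of 4] by auto
  obtain M where M: "M > 0"
    "\<And>x r. r > 0 \<Longrightarrow> measure \<mu> (ball x (2 * r)) \<le> M * measure \<mu> (ball x r)"
    using measure_ball_dilation[OF doubling(2), of 2] by auto
  obtain L where L: "L > 0"
    "\<And>x r. r > 0 \<Longrightarrow> measure \<mu> (ball x (1 / \<theta> * r)) \<le> L * measure \<mu> (ball x r)"
    using measure_ball_dilation[OF doubling(2), of "1 / \<theta>"] \<theta> by auto
  \<comment> \<open>\<open>L\<close> is the cost of passing from \<open>B'\<close> to
    \<open>B_k\<close>, the power of \<open>1 / \<theta>\<close> that of replacing
    \<open>\<delta> ^ k\<close> by a power of the diameter ratio, and the last factor that of
    passing from \<open>B_0\<close> to \<open>B\<close>.\<close>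
  define C where "C = L * (1 / \<theta>) powr \<epsilon> * (2 powr p * N * M)"
  have "C > 0" using L N M \<theta> by (simp add: C_def)
  moreover have "bumped_balance_condition (\<lambda>t. C * t powr \<epsilon>) p \<nu> \<mu>"
    unfolding bumped_balance_condition_iff
  proof (intro allI impI)
    fix x x' :: 'a and r r' :: real
    assume r: "r > 0" and x': "x' \<in> ball x r" and r': "0 < r'" "r' \<le> diameter (ball x r)"
    let ?Q = "ball_quotient p \<nu> \<mu>"
    define d where "d = diameter (ball x r)"
    have d: "0 < d" "d \<le> 2 * r"
      using diam_pos[OF r] diameter_ball_le[OF r] by (auto simp: d_def)
    have "?Q (ball x' d) \<le> 2 powr p * N * M * ?Q (ball x r)"
    proof (rule ball_quotient_comparison)
      show "diameter (ball x' d) \<le> 2 * diameter (ball x r)"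
        using diameter_ball_le[OF d(1)] by (simp add: d_def)
      \<comment> \<open>Points of the left ball are within \<open>d + r\<close>, hence within
        \<open>3 * r\<close>, of \<open>x\<close>.\<close>
      have "ball x' d \<subseteq> ball x (4 * r)"
      proof
        fix z assume "z \<in> ball x' d"
        then show "z \<in> ball x (4 * r)"
          using x' d dist_triangle[of x z x'] by simp
      qed
      then have "measure \<nu> (ball x' d) \<le> measure \<nu> (ball x (4 * r))"
        using r by (intro measure_ball_mono doubling) auto
      also note N(2)[OF r]
      finally show "measure \<nu> (ball x' d) \<le> N * measure \<nu> (ball x r)" .
      \<comment> \<open>Distances from \<open>x'\<close> inside \<open>B\<close> may equal
        \<open>d\<close>, so the open ball needs a radius larger than \<open>d\<close>.\<close>
      have "ball x r \<subseteq> ball x' (2 * d)"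
      proof
        fix z assume "z \<in> ball x r"
        then have "dist x' z \<le> d"
          using diameter_bounded_bound[of "ball x r"] x' unfolding d_def by blast
        then show "z \<in> ball x' (2 * d)" using d by simp
      qed
      then have "measure \<mu> (ball x r) \<le> measure \<mu> (ball x' (2 * d))"
        using d by (intro measure_ball_mono doubling) auto
      also note M(2)[OF d(1)]
      finally show "measure \<mu> (ball x r) \<le> M * measure \<mu> (ball x' d)" .
    qed (use d r p in \<open>auto intro: measure_ball_pos doubling less_imp_le diam_pos\<close>)
    note B\<^sub>0 = this

    have "r' / d \<le> 1" "0 < r' / d" using r' d by (auto simp: d_def)
    obtain n where "\<theta> ^ n < r' / d"
      using real_arch_pow_inv[OF \<open>0 < r' / d\<close> \<theta>(2)] by blast
    \<comment> \<open>The first exponent with \<open>\<theta> ^ n < r' / d\<close> is not 0, since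
      \<open>r' / d \<le> 1\<close>; take \<open>k\<close> to be its predecessor.\<close>
    with \<open>r' / d \<le> 1\<close> obtain k where k: "r' / d \<le> \<theta> ^ k" "\<theta> ^ Suc k < r' / d"
      using ex_least_nat_less[of "\<lambda>n. \<theta> ^ n < r' / d" n] by (force simp: not_less)
    define R where "R = \<theta> ^ k * d"
    have R: "0 < R" "r' \<le> R" "R \<le> 1 / \<theta> * r'"
      using k d \<theta> by (auto simp: R_def field_simps)
    \<comment> \<open>The inclusion of \<open>B'\<close> in \<open>B_k\<close> costs nothing for the
      diameter and \<nu>; only \<mu> needs doubling, by the dilation
      \<open>1 / \<theta>\<close>.\<close>
    have "?Q (ball x' r') \<le> 1 powr p * 1 * L * ?Q (ball x' R)"
    proof (rule ball_quotient_comparison)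
      show "diameter (ball x' r') \<le> 1 * diameter (ball x' R)"
        using R by (auto intro!: diameter_subset)
      show "measure \<nu> (ball x' r') \<le> 1 * measure \<nu> (ball x' R)"
        using measure_ball_mono[OF doubling(1) R(1) subset_ball[OF R(2)]] by simp
      have "measure \<mu> (ball x' R) \<le> measure \<mu> (ball x' (1 / \<theta> * r'))"
        using R by (intro measure_ball_mono doubling subset_ball) auto
      also note L(2)[OF r'(1)]
      finally show "measure \<mu> (ball x' R) \<le> L * measure \<mu> (ball x' r')" .
    qed (use R r' p in \<open>auto intro: measure_ball_pos doubling less_imp_le diam_pos\<close>)
    also have "\<dots> \<le> L * (\<delta> ^ k * ?Q (ball x' d))"
      using L(1) \<theta> d
      by (auto simp: R_def d_def intro!: mult_left_mono concentric_decay[OF bump \<Psi> \<delta>(1)])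
    finally have B': "?Q (ball x' r') \<le> L * (\<delta> ^ k * ?Q (ball x' d))" .

    let ?t = "diameter (ball x' r') / d"
    \<comment> \<open>Turns the radius ratio that determines \<open>k\<close> into the diameter
      ratio \<open>?t\<close>: from \<open>\<theta> ^ Suc k < r' / d \<le> ?t\<close> follows
      \<open>\<theta> ^ k \<le> 1 / \<theta> * ?t\<close>.\<close>
    have "r' \<le> diameter (ball x' r')"
      using conn r' by (rule le_diameter_ball)
    then have "r' / d \<le> ?t" using d by (intro divide_right_mono) auto
    with k(2) have "\<theta> * \<theta> ^ k \<le> \<theta> * (1 / \<theta> * ?t)" using \<theta>(1) by simp
    then have "\<theta> ^ k \<le> 1 / \<theta> * ?t" using \<theta>(1) by (rule mult_left_le_imp_le)
    have "\<delta> ^ k \<le> (\<theta> powr \<epsilon>) ^ k" using \<delta>_le \<delta> by (intro power_mono) auto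
    also have "\<dots> = (\<theta> ^ k) powr \<epsilon>"
      using \<theta> by (simp add: powr_powr mult.commute flip: powr_realpow)
    also have "\<dots> \<le> (1 / \<theta> * ?t) powr \<epsilon>"
      using \<theta> \<epsilon> \<open>\<theta> ^ k \<le> 1 / \<theta> * ?t\<close> by (intro powr_mono2) auto
    also have "\<dots> = (1 / \<theta>) powr \<epsilon> * ?t powr \<epsilon>"
      by (rule powr_mult)
    finally have \<delta>k: "\<delta> ^ k \<le> (1 / \<theta>) powr \<epsilon> * ?t powr \<epsilon>" .

    have "\<delta> ^ k * ?Q (ball x' d)
        \<le> (1 / \<theta>) powr \<epsilon> * ?t powr \<epsilon> * (2 powr p * N * M * ?Q (ball x r))"
      by (rule mult_mono[OF \<delta>k B\<^sub>0]) (auto simp: ball_quotient_def)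
    then have "L * (\<delta> ^ k * ?Q (ball x' d))
        \<le> L * ((1 / \<theta>) powr \<epsilon> * ?t powr \<epsilon> * (2 powr p * N * M * ?Q (ball x r)))"
      using L(1) by (intro mult_left_mono) auto
    with B' show "?Q (ball x' r')
        \<le> C * (diameter (ball x' r') / diameter (ball x r)) powr \<epsilon> * ?Q (ball x r)"
      by (simp add: C_def d_def ac_simps)
  qed
  ultimately have "balance_condition (p - \<epsilon>) \<nu> \<mu>"
    using balance_condition_iff_bumped_powr by blast
  with \<epsilon> show ?thesis by blast
qed

end

theorem theorem3p5:
  fixes \<nu> \<mu> :: "'a::metric_space measure" and p :: real
  assumes "1 < p"
    and "metric_two_measure_space \<nu> \<mu>"
    and "connected (UNIV :: 'a set)"
  shows "(\<exists>\<epsilon>. 0 < \<epsilon> \<and> \<epsilon> < p - 1 \<and> balance_condition (p - \<epsilon>) \<nu> \<mu>) \<longleftrightarrow>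
    (\<exists>\<Psi> :: real \<Rightarrow> real. (\<forall>t>0. \<Psi> t > 0) \<and> bumped_balance_condition \<Psi> p \<nu> \<mu> \<and>
       (\<exists>t\<^sub>0>0. \<exists>\<delta>. 0 < \<delta> \<and> \<delta> < 1 \<and> (\<forall>t. 0 < t \<and> t \<le> t\<^sub>0 \<longrightarrow> \<Psi> t \<le> \<delta>)))"
  (is "?A \<longleftrightarrow> ?B")
proof
  assume ?A
  then show ?B using balance_condition_imp_small_bump[OF assms(2,3)] by blast
next
  assume ?B
  then show ?A using small_bump_imp_balance_condition[OF assms(2,3,1)] by blast
qed

end
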